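(* Let $p$ be an odd prime, let $m,n$ be non-negative integers, and let $c_0+c_1p+\cdots+c_{r_m}p^{r_m}$ be the $p$-adic expansion of $m$ with $0\le c_i\le p-1$. Let $s_m$ be the number of zeros in the sequence $(c_1,\dots,c_{r_m})$. Then for $r\ge r_m+1$, $$N_r(m,n)\ge\binom{r_m-s_m}{2\,\mathrm{ht}(m)-c_0-n}.$$ In particular, equality holds when $n\le 2p-2$.
   Context: For $m,n\in\mathbb N=\{0,1,2,\dots\}$ and $r\ge1$, $N_r(m,n)$ is the number of pairs $(\mathfrak a,\mathfrak b)$, $\mathfrak a=(a_1,\dots,a_r)\in\mathbb N^r$, $\mathfrak b=(b_1,\dots,b_r)\in\{0,1\}^r$, satisfying $2\sum_{i=1}^r a_i+\sum_{j=1}^r b_j=n$ and $b_1+\sum_{i=1}^{r-1}(a_i+b_{i+1})p^i+a_rp^r=m$. Here $r_m$ is the largest integer $\ge0$ with $p^{r_m}\le m$ (and $r_0=0$), and $\mathrm{ht}(m)=\sum_{i=0}^{r_m}c_i$. Binomial coefficients $\binom ab$ are $0$ if $b<0$ or $b>a$.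
   Formalization: The formal theorem adds the hypothesis c_0 ≤ 1 (m ≡ 0 or 1 mod p); for every m with c_0 ≥ 2 the printed bound fails at n = 2ht(m) − c_0, e.g. p=3, m=2, n=2, r=1 gives N=0 but the binomial is 1. *)

theory Defs
  imports "HOL-Computational_Algebra.Primes" "HOL-Library.FuncSet"
begin

text \<open>
  An r-tuple is an extensional function on \<open>{1..r}\<close> (value \<open>undefined\<close> outside), so that counting
  functions is counting tuples.
\<close>

definition sols :: "nat \<Rightarrow> nat \<Rightarrow> nat \<Rightarrow> nat \<Rightarrow> ((nat \<Rightarrow> nat) \<times> (nat \<Rightarrow> nat)) set" where
  "sols p r m n =
     {(a, b). a \<in> {1..r} \<rightarrow>\<^sub>E UNIV \<and> b \<in> {1..r} \<rightarrow>\<^sub>E {0, 1} \<and>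
        2 * (\<Sum>i = 1..r. a i) + (\<Sum>j = 1..r. b j) = n \<and>
        b 1 + (\<Sum>i = 1..r - 1. (a i + b (i + 1)) * p ^ i) + a r * p ^ r = m}"

text \<open>The set is finite, the first equation bounding every \<open>a i\<close> by \<open>n\<close>, so \<open>card\<close> is meaningful.\<close>

definition N :: "nat \<Rightarrow> nat \<Rightarrow> nat \<Rightarrow> nat \<Rightarrow> nat" where
  "N p r m n = card (sols p r m n)"

definition top_exp :: "nat \<Rightarrow> nat \<Rightarrow> nat" where
  "top_exp p m = (if m = 0 then 0 else (GREATEST k. p ^ k \<le> m))"

definition padic_expansion :: "nat \<Rightarrow> nat \<Rightarrow> (nat \<Rightarrow> nat) \<Rightarrow> bool" where
  "padic_expansion p m c \<longleftrightarrow>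
     (\<forall>i \<le> top_exp p m. c i \<le> p - 1) \<and> m = (\<Sum>i = 0..top_exp p m. c i * p ^ i)"

definition ht :: "nat \<Rightarrow> nat \<Rightarrow> (nat \<Rightarrow> nat) \<Rightarrow> nat" where
  "ht p m c = (\<Sum>i = 0..top_exp p m. c i)"

definition zeros :: "nat \<Rightarrow> nat \<Rightarrow> (nat \<Rightarrow> nat) \<Rightarrow> nat" where
  "zeros p m c = card {i \<in> {1..top_exp p m}. c i = 0}"

text \<open>
  The lower index is an integer, with value 0 when it is negative; \<open>choose\<close> is already 0 when it
  exceeds the upper one.
\<close>

definition binom :: "nat \<Rightarrow> int \<Rightarrow> nat" where
  "binom a b = (if b < 0 then 0 else a choose nat b)"

text \<open>
  Reducing the second equation modulo \<open>p\<close> gives \<open>m mod p = b 1 \<in> {0, 1}\<close>.  Hence there are no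
  solutions at all if the last digit \<open>c 0\<close> of \<open>m\<close> is at least 2, whereas the lower bound of the
  theorem is then 1 for \<open>n = 2 * ht p m c - c 0\<close>.  So the bound is false for every such \<open>m\<close>,
  and the theorem has to assume \<open>c 0 \<le> 1\<close>.
\<close>

lemma N_eq_0_if_last_digit_ge_2:
  assumes "m mod p \<ge> 2" and "r \<ge> 1"
  shows "N p r m n = 0"
proof -
  have False if "(a, b) \<in> sols p r m n" for a b
  proof -
    let ?S = "\<Sum>i = 1..r - 1. (a i + b (i + 1)) * p ^ i"
    from that have b: "b \<in> {1..r} \<rightarrow>\<^sub>E {0, 1}" and m: "b 1 + ?S + a r * p ^ r = m"
      unfolding sols_def by simp_all
    have "b 1 \<in> {0, 1}"
      using assms(2) by (intro PiE_mem[OF b]) simp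
    moreover have "p dvd ?S"
      by (intro dvd_sum dvd_mult dvd_power) auto
    moreover have "p dvd a r * p ^ r"
      using assms(2) by (intro dvd_mult dvd_power) auto
    ultimately have dvd: "p dvd ?S + a r * p ^ r" and b1: "b 1 \<le> 1"
      by (blast intro: dvd_add, force)
    from dvd obtain q where "?S + a r * p ^ r = p * q"
      by blast
    then have "m = b 1 + p * q"
      using m by linarith
    then have "m mod p = b 1 mod p"
      by simp
    also have "\<dots> \<le> 1"
      using b1 mod_less_eq_dividend le_trans by blast
    finally show False
      using assms(1) by simp
  qed
  then have "sols p r m n = {}"
    by auto
  then show ?thesis
    by (simp add: N_def)
qed

lemma bound_fails_if_last_digit_ge_2:
  assumes "2 \<le> p" and "padic_expansion p m c" and "c 0 \<ge> 2" and "r \<ge> top_exp p m + 1"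
  shows "N p r m (2 * ht p m c - c 0) <
           binom (top_exp p m - zeros p m c)
             (2 * int (ht p m c) - int (c 0) - int (2 * ht p m c - c 0))"
proof -
  let ?R = "top_exp p m"
  have "m = c 0 + (\<Sum>i = Suc 0..?R. c i * p ^ i)"
  proof -
    have "m = (\<Sum>i = 0..?R. c i * p ^ i)"
      using assms(2) unfolding padic_expansion_def by (rule conjunct2)
    also have "\<dots> = c 0 * p ^ 0 + (\<Sum>i = Suc 0..?R. c i * p ^ i)"
      by (rule sum.atLeast_Suc_atMost) (rule le0)
    finally show ?thesis
      by (simp only: power_0 mult_1_right)
  qed
  moreover have "p dvd (\<Sum>i = Suc 0..?R. c i * p ^ i)"
    by (intro dvd_sum dvd_mult dvd_power) auto
  ultimately have "m mod p = c 0 mod p"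
    by (metis add_0_right dvd_imp_mod_0 mod_add_right_eq)
  moreover have "c 0 < p"
  proof -
    have "c 0 \<le> p - 1"
      using assms(2) unfolding padic_expansion_def by blast
    then show ?thesis
      using assms(1) by linarith
  qed
  ultimately have "m mod p \<ge> 2"
    using assms(3) by simp
  then have N: "N p r m (2 * ht p m c - c 0) = 0"
    using assms(4) by (intro N_eq_0_if_last_digit_ge_2) auto
  have "c 0 \<le> ht p m c"
    unfolding ht_def by (rule member_le_sum) auto
  then have index: "2 * int (ht p m c) - int (c 0) - int (2 * ht p m c - c 0) = 0"
    by linarith
  show ?thesis
    unfolding N index by (simp add: binom_def)
qed

end

theory Submission
  imports Defs
begin

text \<open>
  Put \<open>d\<^sub>0 = b\<^sub>1\<close>, \<open>d\<^sub>i = a\<^sub>i + b\<^sub>i\<^sub>+\<^sub>1\<close> for \<open>0 < i < r\<close> and \<open>d\<^sub>r = a\<^sub>r\<close>.  The second equation says that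
  the \<open>d\<^sub>i\<close> are the coefficients of some, not necessarily reduced, expansion of \<open>m\<close> in base \<open>p\<close>.
  For a given \<open>d\<close>, a solution is determined by the set of those \<open>0 < i < r\<close> with \<open>b\<^sub>i\<^sub>+\<^sub>1 = 1\<close>.  This
  is a subset of the support of \<open>d\<close>, and the first equation fixes its size to be
  \<open>2 (d\<^sub>0 + \<dots> + d\<^sub>r) - d\<^sub>0 - n\<close>.  Taking for \<open>d\<close> the \<open>p\<close>-adic digits of \<open>m\<close> gives the lower bound.
  If \<open>d\<close> is not reduced, some \<open>d\<^sub>i \<ge> p\<close>; then \<open>a\<^sub>i \<ge> p - 1\<close> and \<open>b\<^sub>i\<^sub>+\<^sub>1 = 1\<close>, or \<open>a\<^sub>i \<ge> p\<close>, which
  forces \<open>n \<ge> 2 p - 1\<close>.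
\<close>

definition coeff_seq :: "nat \<Rightarrow> (nat \<Rightarrow> nat) \<Rightarrow> (nat \<Rightarrow> nat) \<Rightarrow> nat \<Rightarrow> nat" where
  "coeff_seq r a b i = (if i = 0 then b 1 else if i = r then a r else a i + b (i + 1))"

text \<open>The fibre over \<open>d\<close> of the map sending a solution to its coefficients.
  Agreement stops at \<open>r\<close>, since beyond it \<open>coeff_seq\<close> only adds
  \<open>undefined\<close> values.\<close>

definition fibre :: "nat \<Rightarrow> nat \<Rightarrow> (nat \<Rightarrow> nat) \<Rightarrow> ((nat \<Rightarrow> nat) \<times> (nat \<Rightarrow> nat)) set" where
  "fibre r n d =
     {(a, b). a \<in> {1..r} \<rightarrow>\<^sub>E UNIV \<and> b \<in> {1..r} \<rightarrow>\<^sub>E {0, 1} \<and>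
        2 * (\<Sum>i = 1..r. a i) + (\<Sum>j = 1..r. b j) = n \<and> (\<forall>i\<le>r. coeff_seq r a b i = d i)}"

text \<open>The weight is kept general to serve twice: \<open>p ^ i\<close> gives the second
  equation, the constant 1 gives the total of the coefficients.\<close>

lemma sum_coeff_seq:
  assumes "r \<ge> 1"
  shows "(\<Sum>i\<le>r. coeff_seq r a b i * w i) =
    b 1 * w 0 + (\<Sum>i = 1..r - 1. (a i + b (i + 1)) * w i) + a r * w r"
proof -
  obtain q where r: "r = Suc q" using assms by (cases r) auto
  have "(\<Sum>i\<le>r. coeff_seq r a b i * w i) =
      (\<Sum>i\<le>q. coeff_seq r a b i * w i) + a r * w r"
    by (simp add: r coeff_seq_def)
  also have "(\<Sum>i\<le>q. coeff_seq r a b i * w i) =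
      b 1 * w 0 + (\<Sum>i = 1..q. coeff_seq r a b i * w i)"
    by (simp add: atMost_atLeast0 sum.atLeast_Suc_atMost coeff_seq_def)
  also have "(\<Sum>i = 1..q. coeff_seq r a b i * w i) = (\<Sum>i = 1..q. (a i + b (i + 1)) * w i)"
    by (intro sum.cong) (auto simp: coeff_seq_def r)
  finally show ?thesis by (simp add: r)
qed

lemma sols_eq_coeff_seq:
  assumes "r \<ge> 1"
  shows "sols p r m n =
    {(a, b). a \<in> {1..r} \<rightarrow>\<^sub>E UNIV \<and> b \<in> {1..r} \<rightarrow>\<^sub>E {0, 1} \<and>
        2 * (\<Sum>i = 1..r. a i) + (\<Sum>j = 1..r. b j) = n \<and>
        (\<Sum>i\<le>r. coeff_seq r a b i * p ^ i) = m}"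
  unfolding sols_def sum_coeff_seq[OF assms] by simp

text \<open>Each \<open>a i\<close> and each \<open>b j\<close> enters exactly one coefficient.
  After doubling, one copy of every \<open>b j\<close> completes the first equation and the other
  copy is left over, so the leftover measures how many \<open>b j\<close> equal 1.\<close>

lemma two_sum_coeff_seq:
  assumes "r \<ge> 1"
  shows "2 * (\<Sum>i\<le>r. coeff_seq r a b i) =
    2 * (\<Sum>i = 1..r. a i) + (\<Sum>j = 1..r. b j) + b 1 + (\<Sum>i = 1..r - 1. b (i + 1))"
proof -
  obtain q where r: "r = Suc q" using assms by (cases r) auto
  have "(\<Sum>j = 1..r. b j) = b 1 + (\<Sum>i = 1..q. b (i + 1))"
    unfolding r One_nat_def
    by (subst sum.atLeast_Suc_atMost, simp, subst sum.shift_bounds_cl_Suc_ivl, simp)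
  then show ?thesis
    using sum_coeff_seq[OF assms, where w = "\<lambda>_. 1"] by (simp add: r sum.distrib)
qed

lemma sum_eq_card_level_one:
  fixes f :: "'a \<Rightarrow> nat"
  assumes "finite A" and "\<And>x. x \<in> A \<Longrightarrow> f x \<le> 1"
  shows "sum f A = card {x \<in> A. f x = 1}"
proof -
  have "sum f A = (\<Sum>x\<in>A. if f x = 1 then 1 else 0)"
    using assms(2) by (intro sum.cong) (auto simp: le_Suc_eq)
  then show ?thesis
    using assms(1) by (simp add: sum.If_cases Int_def)
qed

lemma card_fibre:
  assumes "r \<ge> 1" and "d 0 \<le> 1"
  shows "card (fibre r n d) =
    binom (card {i \<in> {1..r - 1}. d i \<noteq> 0}) (2 * int (\<Sum>i\<le>r. d i) - int (d 0) - int n)"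
proof -
  define Z where "Z = {i \<in> {1..r - 1}. d i \<noteq> 0}"
  define K where "K = 2 * int (\<Sum>i\<le>r. d i) - int (d 0) - int n"
  define \<phi> :: "(nat \<Rightarrow> nat) \<times> (nat \<Rightarrow> nat) \<Rightarrow> nat set"
    where "\<phi> = (\<lambda>(a, b). {i \<in> {1..r - 1}. b (i + 1) = 1})"
  \<comment> \<open>The inverse of \<open>\<phi>\<close>: each \<open>i\<close> in \<open>B\<close>
    passes one unit of \<open>d i\<close> on to \<open>b (i + 1)\<close>. For
    \<open>B \<subseteq> Z\<close> the truncated subtraction is exact, and the value at
    \<open>r\<close> stays \<open>d r\<close> because \<open>Z\<close> omits
    \<open>r\<close>.\<close>
  define A where "A B = (\<lambda>i\<in>{1..r}. if i \<in> B then d i - 1 else d i)" for B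
  define S where "S B = (\<lambda>j\<in>{1..r}. if j = 1 then d 0 else if j - 1 \<in> B then 1 else 0)" for B
  have card_eq_iff: "int (card (\<phi> (a, b))) = K \<longleftrightarrow>
      2 * (\<Sum>i = 1..r. a i) + (\<Sum>j = 1..r. b j) = n"
    if b: "b \<in> {1..r} \<rightarrow>\<^sub>E {0, 1}" and d: "\<forall>i\<le>r. coeff_seq r a b i = d i" for a b
  proof -
    have "b (i + 1) \<le> 1" if "i \<in> {1..r - 1}" for i
      using PiE_mem[OF b, of "i + 1"] that assms(1) by force
    then have "(\<Sum>i = 1..r - 1. b (i + 1)) = card (\<phi> (a, b))"
      unfolding \<phi>_def prod.case by (intro sum_eq_card_level_one) auto
    moreover have "(\<Sum>i\<le>r. coeff_seq r a b i) = (\<Sum>i\<le>r. d i)"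
      using d by (intro sum.cong) auto
    moreover have "b 1 = d 0"
      using d by (auto simp: coeff_seq_def)
    ultimately show ?thesis
      using two_sum_coeff_seq[OF assms(1), of a b] unfolding K_def by linarith
  qed
  have coeff: "coeff_seq r (A B) (S B) i = d i" if "B \<subseteq> Z" "i \<le> r" for B i
    using that assms(1) by (auto simp: coeff_seq_def A_def S_def Z_def)
  have S_PiE: "S B \<in> {1..r} \<rightarrow>\<^sub>E {0, 1}" for B
    using assms(2) by (auto simp: S_def split: if_splits)
  have \<phi>_inv: "\<phi> (A B, S B) = B" if "B \<subseteq> Z" for B
    using that by (auto simp: \<phi>_def S_def Z_def)
  have "bij_betw \<phi> (fibre r n d) {B. B \<subseteq> Z \<and> int (card B) = K}"
  proof (rule bij_betw_byWitness[where f' = "\<lambda>B. (A B, S B)"])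
    show "\<forall>x\<in>fibre r n d. (A (\<phi> x), S (\<phi> x)) = x"
    proof clarify
      fix a b assume "(a, b) \<in> fibre r n d"
      then have a: "a \<in> {1..r} \<rightarrow>\<^sub>E UNIV" and b: "b \<in> {1..r} \<rightarrow>\<^sub>E {0, 1}"
        and d: "\<And>i. i \<le> r \<Longrightarrow> coeff_seq r a b i = d i"
        by (auto simp: fibre_def)
      have b01: "b j = 0 \<or> b j = 1" if "j \<in> {1..r}" for j
        using PiE_mem[OF b that] by auto
      have "A (\<phi> (a, b)) i = a i" for i
        using PiE_arb[OF a, of i] d[of i] b01[of "i + 1"]
        by (auto simp: A_def \<phi>_def coeff_seq_def split: if_splits)
      moreover have "S (\<phi> (a, b)) j = b j" for j
        using PiE_arb[OF b, of j] d[of 0] b01[of j]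
        by (auto simp: S_def \<phi>_def coeff_seq_def)
      ultimately show "A (\<phi> (a, b)) = a \<and> S (\<phi> (a, b)) = b"
        by auto
    qed
    show "\<forall>B\<in>{B. B \<subseteq> Z \<and> int (card B) = K}. \<phi> (A B, S B) = B"
      using \<phi>_inv by blast
    show "\<phi> ` fibre r n d \<subseteq> {B. B \<subseteq> Z \<and> int (card B) = K}"
    proof clarify
      fix a b assume ab: "(a, b) \<in> fibre r n d"
      then have "int (card (\<phi> (a, b))) = K"
        by (subst card_eq_iff) (auto simp: fibre_def)
      moreover have "\<phi> (a, b) \<subseteq> Z"
      proof
        \<comment> \<open>Here \<open>b (i + 1) = 1\<close> is a summand of the coefficient at
          \<open>i\<close>, so \<open>d i\<close> is positive.\<close>
        fix i assume i: "i \<in> \<phi> (a, b)"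
        then have "coeff_seq r a b i = d i"
          using ab by (auto simp: fibre_def \<phi>_def)
        with i show "i \<in> Z"
          by (auto simp: \<phi>_def Z_def coeff_seq_def split: if_splits)
      qed
      ultimately show "\<phi> (a, b) \<subseteq> Z \<and> int (card (\<phi> (a, b))) = K"
        by blast
    qed
    show "(\<lambda>B. (A B, S B)) ` {B. B \<subseteq> Z \<and> int (card B) = K} \<subseteq> fibre r n d"
    proof clarify
      fix B assume B: "B \<subseteq> Z" "K = int (card B)"
      have "2 * (\<Sum>i = 1..r. A B i) + (\<Sum>j = 1..r. S B j) = n"
        using card_eq_iff[OF S_PiE, of "A B" B] coeff[OF B(1)] \<phi>_inv[OF B(1)] B(2) by simp
      then show "(A B, S B) \<in> fibre r n d"
        using coeff[OF B(1)] S_PiE by (auto simp: fibre_def A_def)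
    qed
  qed
  then have "card (fibre r n d) = card {B. B \<subseteq> Z \<and> int (card B) = K}"
    by (rule bij_betw_same_card)
  also have "\<dots> = binom (card Z) K"
  proof (cases "K < 0")
    case True
    then show ?thesis by (simp add: binom_def)
  next
    case False
    then have "{B. B \<subseteq> Z \<and> int (card B) = K} = {B. B \<subseteq> Z \<and> card B = nat K}"
      by auto
    then show ?thesis
      using False by (simp add: binom_def n_subsets Z_def)
  qed
  finally show ?thesis
    unfolding Z_def K_def .
qed

text \<open>Reduction modulo \<open>p\<close> identifies the lowest digits; cancelling them and
  dividing by \<open>p\<close> leaves shorter expansions for the induction.\<close>

lemma base_digits_unique:
  fixes e f :: "nat \<Rightarrow> nat"
  assumes "\<And>i. i \<le> k \<Longrightarrow> e i < p" and "\<And>i. i \<le> k \<Longrightarrow> f i < p"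
    and "(\<Sum>i\<le>k. e i * p ^ i) = (\<Sum>i\<le>k. f i * p ^ i)" and "i \<le> k"
  shows "e i = f i"
  using assms
proof (induction k arbitrary: e f i)
  case 0
  then show ?case by simp
next
  case (Suc k)
  have split: "(\<Sum>i\<le>Suc k. g i * p ^ i) = g 0 + p * (\<Sum>i\<le>k. g (Suc i) * p ^ i)"
    for g :: "nat \<Rightarrow> nat"
    unfolding sum.atMost_Suc_shift sum_distrib_left by (simp add: mult_ac)
  have eq: "e 0 + p * (\<Sum>i\<le>k. e (Suc i) * p ^ i) = f 0 + p * (\<Sum>i\<le>k. f (Suc i) * p ^ i)"
    using Suc.prems(3) unfolding split .
  have "e 0 < p" "f 0 < p" using Suc.prems(1,2) by auto
  then have e0: "e 0 = f 0"
    using arg_cong[OF eq, of "\<lambda>x. x mod p"] by simp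
  \<comment> \<open>The bound on \<open>e 0\<close> also gives \<open>p > 0\<close>, which allows
    cancelling the factor \<open>p\<close>.\<close>
  with eq \<open>e 0 < p\<close> have "(\<Sum>i\<le>k. e (Suc i) * p ^ i) = (\<Sum>i\<le>k. f (Suc i) * p ^ i)"
    by auto
  then have "e (Suc j) = f (Suc j)" if "j \<le> k" for j
    using Suc.prems(1,2) that by (intro Suc.IH[of "\<lambda>i. e (Suc i)" "\<lambda>i. f (Suc i)"]) auto
  with e0 Suc.prems(4) show ?case by (cases i) auto
qed

text \<open>Infinite sets have \<open>card\<close> 0, so monotonicity of \<open>card\<close>, hence
  the lower bound, depends on this.\<close>

lemma finite_sols: "finite (sols p r m n)"
proof (rule finite_subset)
  show "sols p r m n \<subseteq> ({1..r} \<rightarrow>\<^sub>E {..n}) \<times> ({1..r} \<rightarrow>\<^sub>E {0, 1})"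
  proof clarify
    fix a b assume "(a, b) \<in> sols p r m n"
    then have a: "a \<in> {1..r} \<rightarrow>\<^sub>E UNIV" and b: "b \<in> {1..r} \<rightarrow>\<^sub>E {0, 1}"
      and n: "2 * (\<Sum>i = 1..r. a i) + (\<Sum>j = 1..r. b j) = n"
      by (auto simp: sols_def)
    have "a i \<le> n" if "i \<in> {1..r}" for i
      using member_le_sum[of i "{1..r}" a] that n by simp
    with a b show "a \<in> {1..r} \<rightarrow>\<^sub>E {..n} \<and> b \<in> {1..r} \<rightarrow>\<^sub>E {0, 1}"
      by (auto simp: PiE_iff)
  qed
qed (intro finite_cartesian_product finite_PiE; simp)

lemma coeff_seq_reduced:
  assumes "2 \<le> p" and "r \<ge> 1" and "b \<in> {1..r} \<rightarrow>\<^sub>E {0, 1}"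
    and "2 * (\<Sum>i = 1..r. a i) + (\<Sum>j = 1..r. b j) \<le> 2 * p - 2" and "i \<le> r"
  shows "coeff_seq r a b i < p"
proof -
  have b_le: "b j \<le> 1" if "j \<in> {1..r}" for j
    using PiE_mem[OF assms(3) that] by auto
  have b_sum: "b j \<le> (\<Sum>j = 1..r. b j)" if "j \<in> {1..r}" for j
    using that by (intro member_le_sum) auto
  have a_sum: "a i \<le> (\<Sum>i = 1..r. a i)" if "i \<noteq> 0"
    using that assms(5) by (intro member_le_sum) auto
  consider "i = 0" | "i \<noteq> 0" "i = r" | "i \<noteq> 0" "i < r"
    using assms(5) by linarith
  then show ?thesis
  proof cases
    case 1
    then show ?thesis
      using b_le[of 1] assms(1,2) by (simp add: coeff_seq_def)
  next
    case 2
    then show ?thesis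
      using a_sum assms(1,4) by (simp add: coeff_seq_def)
  next
    case 3
    \<comment> \<open>If the sum were at least \<open>p\<close>, then
      \<open>2 * a i + b (i + 1)\<close> would be at least \<open>2 * p - b (i + 1)\<close>, hence
      at least \<open>2 * p - 1\<close>.\<close>
    then have "a i + b (i + 1) < p"
      using a_sum b_le[of "i + 1"] b_sum[of "i + 1"] assms(1,4) by simp
    then show ?thesis
      using 3 by (simp add: coeff_seq_def)
  qed
qed

theorem lemma3p1:
  fixes p m n r :: nat and c :: "nat \<Rightarrow> nat"
  assumes "prime p" and "odd p"
    and "padic_expansion p m c"
    and "c 0 \<le> 1"
    and "r \<ge> top_exp p m + 1"
  shows "N p r m n \<ge>
           binom (top_exp p m - zeros p m c) (2 * int (ht p m c) - int (c 0) - int n) \<and>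
         (n \<le> 2 * p - 2 \<longrightarrow>
           N p r m n =
             binom (top_exp p m - zeros p m c) (2 * int (ht p m c) - int (c 0) - int n))"
proof -
  define R where "R = top_exp p m"
  \<comment> \<open>The digits are padded with zeros, as the values of \<open>c\<close> above
    \<open>R\<close> are unspecified.\<close>
  define d where "d i = (if i \<le> R then c i else 0)" for i
  have p2: "2 \<le> p" using assms(1) by (rule prime_ge_2_nat)
  have r1: "r \<ge> 1" and Rr: "R < r" using assms(5) by (auto simp: R_def)
  have d_lt: "d i < p" for i
  proof (cases "i \<le> R")
    case True
    then have "c i \<le> p - 1"
      using assms(3) unfolding padic_expansion_def R_def by blast
    then show ?thesis
      using True p2 by (simp add: d_def)
  qed (use p2 in \<open>simp add: d_def\<close>)
  have pad: "(\<Sum>i\<le>r. d i * w i) = (\<Sum>i = 0..R. c i * w i)" for w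
    using Rr by (intro sum.mono_neutral_cong_right) (auto simp: d_def)
  have m: "(\<Sum>i\<le>r. d i * p ^ i) = m"
    using assms(3) unfolding padic_expansion_def pad R_def by simp
  have ht: "(\<Sum>i\<le>r. d i) = ht p m c"
    using pad[of "\<lambda>_. 1"] by (simp add: ht_def R_def)
  \<comment> \<open>Since \<open>R < r\<close>, the range \<open>{1..r - 1}\<close> contains every
    index from 1 to \<open>R\<close>, and padding adds no nonzero digit.\<close>
  have support: "card {i \<in> {1..r - 1}. d i \<noteq> 0} = R - zeros p m c"
  proof -
    have "{i \<in> {1..r - 1}. d i \<noteq> 0} = {1..R} - {i \<in> {1..R}. c i = 0}"
      using Rr by (auto simp: d_def split: if_splits)
    also have "card \<dots> = R - zeros p m c"
      by (subst card_Diff_subset) (auto simp: zeros_def R_def)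
    finally show ?thesis .
  qed
  have card: "card (fibre r n d) =
      binom (top_exp p m - zeros p m c) (2 * int (ht p m c) - int (c 0) - int n)"
    using card_fibre[OF r1, of d n] assms(4) unfolding support ht by (simp add: d_def R_def)
  have sub: "fibre r n d \<subseteq> sols p r m n"
    unfolding sols_eq_coeff_seq[OF r1] fibre_def using m by auto
  \<comment> \<open>For small \<open>n\<close> all coefficients are reduced, so by uniqueness of
    digits only the fibre over \<open>d\<close> is left.\<close>
  have "sols p r m n \<subseteq> fibre r n d" if n: "n \<le> 2 * p - 2"
  proof clarify
    fix a b assume "(a, b) \<in> sols p r m n"
    then have a: "a \<in> {1..r} \<rightarrow>\<^sub>E UNIV" and b: "b \<in> {1..r} \<rightarrow>\<^sub>E {0, 1}"
      and n': "2 * (\<Sum>i = 1..r. a i) + (\<Sum>j = 1..r. b j) = n"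
      and m': "(\<Sum>i\<le>r. coeff_seq r a b i * p ^ i) = m"
      unfolding sols_eq_coeff_seq[OF r1] by auto
    have "coeff_seq r a b i = d i" if "i \<le> r" for i
    proof (rule base_digits_unique[where e = "coeff_seq r a b" and f = d and k = r and p = p])
      show "coeff_seq r a b j < p" if "j \<le> r" for j
        using coeff_seq_reduced[OF p2 r1 b _ that] n n' by simp
    qed (use d_lt m m' that in auto)
    with a b n' show "(a, b) \<in> fibre r n d"
      by (auto simp: fibre_def)
  qed
  with sub have "N p r m n = card (fibre r n d)" if "n \<le> 2 * p - 2"
    using that by (auto simp: N_def)
  moreover have "card (fibre r n d) \<le> N p r m n"
    unfolding N_def by (intro card_mono finite_sols sub)
  ultimately show ?thesis
    unfolding card by blast
qed

end
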